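(* The DRCC-OTS problem under the $\infty$-Wasserstein ambiguity set $\mathcal P_2$, i.e. the problem of minimizing $\boldsymbol c^{\mathsf T}\boldsymbol g+\mathbb E[\boldsymbol q^{\mathsf T}\boldsymbol\gamma\mathbf e^{\mathsf T}\boldsymbol\xi]$ over decisions $\mathbf x$ satisfying the deterministic constraints (D) and the distributionally robust chance constraints $$\inf_{\mathbb P\in\mathcal P_2}\mathbb P\{\mathbf a_i(\mathbf x)^{\mathsf T}\boldsymbol\xi\le b_i(\mathbf x)\}\ge 1-\epsilon_i\qquad\forall i\in\mathcal I,$$ is equivalent to the following optimization problem (same objective, and the same feasible decisions $\mathbf x$ once the auxiliary binary variables are projected out): $$\min\ \boldsymbol c^{\mathsf T}\boldsymbol g+\mathbb E[\boldsymbol q^{\mathsf T}\boldsymbol\gamma\mathbf e^{\mathsf T}\boldsymbol\xi]$$ subject to the constraints (D) and $$\begin{aligned} & w_i^j\in\{0,1\} &&\forall i\in\mathcal I,\ j\in\mathcal J,\\ & \textstyle\sum_{j=1}^S w_i^j\le S\epsilon_i &&\forall i\in\mathcal I,\\ & \delta\,\|\mathbf a_i(\mathbf x)\|_*\le b_i(\mathbf x)-\mathbf a_i(\mathbf x)^{\mathsf T}\boldsymbol\xi^j+\mathrm M_j w_i^j &&\forall i\in\mathcal I,\ j\in\mathcal J. \end{aligned}$$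
   Context: Notation: $\circ$ is the component-wise product, vector inequalities are component-wise, $\mathbf e$ is the all-ones vector, and $\mathcal P_0(\cdot)$ denotes the set of all probability distributions supported on the given set. $\|\cdot\|$ is a norm on $\mathbb R^K$ and $\|\cdot\|_*$ its dual norm. Uncertainty: $\boldsymbol\xi\in\mathbb R^K$ has support $\boldsymbol\Xi=\{\boldsymbol\xi\in\mathbb R^K:\mathbf U\boldsymbol\xi\le\mathbf t\}$, a compact full-dimensional polytope, with $\mathbf U\in\mathbb R^{W\times K}$, $\mathbf t\in\mathbb R^W$. The mean $\mathbb E[\boldsymbol\xi]=\boldsymbol\mu$ is known, so that the second term of the objective equals $\boldsymbol q^{\mathsf T}\boldsymbol\gamma\,\mathbf e^{\mathsf T}\boldsymbol\mu$. Samples $\boldsymbol\xi^j$, $j\in\mathcal J=\{1,\dots,S\}$, are given, and $\hat{\mathbb P}$ is the empirical distribution assigning mass $1/S$ to each sample. For a radius $\delta>0$, $$\mathcal P_2=\{\mathbb P\in\mathcal P_0(\boldsymbol\Xi):\ d_\infty(\mathbb P,\hat{\mathbb P})\le\delta\},$$ where the $\infty$-Wasserstein distance $d_\infty(\mathbb P_1,\mathbb P_2)$ is the infimum, over all joint distributions $\mathbb P\in\mathcal P_0(\mathbb R^K\times\mathbb R^K)$ of $(\tilde{\boldsymbol\xi}_1,\tilde{\boldsymbol\xi}_2)$ with marginals $\mathbb P_1$ and $\mathbb P_2$, of the essential supremum of $\|\tilde{\boldsymbol\xi}_1-\tilde{\boldsymbol\xi}_2\|$ with respect to $\mathbb P$.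 Big-M coefficients: it is supposed that for each $j\in\mathcal J$ a constant $\mathrm M_j$ exists with $\mathrm M_j\ge\max_{\mathbf x}\{\mathbf a_i(\mathbf x)^{\mathsf T}\boldsymbol\xi^j+\delta\|\mathbf a_i(\mathbf x)\|_*-b_i(\mathbf x)\}$ for every $i\in\mathcal I$ (maximum over the decisions $\mathbf x$ satisfying (D)). Network data: $N$ buses, $L$ lines; incidence matrix $\mathbf A\in\mathbb Z^{N\times L}$ (column $\mathbf e_i-\mathbf e_j$ for line $(i,j)$); $\mathbf K\in\mathbb R^{L\times N}$ (row $b_{ij}(\mathbf e_i-\mathbf e_j)^{\mathsf T}$, $b_{ij}$ the inverse line reactance); load $\boldsymbol d\in\mathbb R^N$; cost vectors $\boldsymbol c,\boldsymbol q\in\mathbb R^N$; bounds $\underline{\boldsymbol g},\overline{\boldsymbol g},\underline{\boldsymbol\theta},\overline{\boldsymbol\theta},\underline{\boldsymbol r},\overline{\boldsymbol r}\in\mathbb R^N$ and $\underline{\boldsymbol f},\overline{\boldsymbol f}\in\mathbb R^L$; big-M vector $\mathbf M\in\mathbb R^L$ with sufficiently large entries; maximal number $L_o$ of open lines; matrix $\mathbf F\in\mathbb R^{N\times K}$ mapping the uncertainty to the buses; tolerances $\epsilon_i\in(0,1)$. Decisions $\mathbf x$: $\boldsymbol g,\boldsymbol\theta\in\mathbb R^N$, $\boldsymbol f\in\mathbb R^L$, $\boldsymbol z\in\{0,1\}^L$, $\boldsymbol\gamma\in[0,1]^N$, together with the recourse matrices $\boldsymbol Y_\theta\in\mathbb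 R^{N\times K}$, $\boldsymbol Y_f\in\mathbb R^{L\times K}$ and the dual matrices $\boldsymbol\Phi_1,\boldsymbol\Phi_2\in\mathbb R_+^{W\times L}$. Constraints (D): - $\mathbf e^{\mathsf T}\boldsymbol\gamma=1$; $\underline{\boldsymbol g}\le\boldsymbol g\le\overline{\boldsymbol g}$; $\underline{\boldsymbol\theta}\le\boldsymbol\theta\le\overline{\boldsymbol\theta}$; $\underline{\boldsymbol f}\circ\boldsymbol z\le\boldsymbol f\le\overline{\boldsymbol f}\circ\boldsymbol z$; $\mathbf A\boldsymbol f=\boldsymbol g-\boldsymbol d$; - $\mathbf K\boldsymbol\theta-\boldsymbol f+\mathbf M\circ(\mathbf e-\boldsymbol z)\ge\mathbf 0$; $\mathbf K\boldsymbol\theta-\boldsymbol f-\mathbf M\circ(\mathbf e-\boldsymbol z)\le\mathbf 0$; $\mathbf e^{\mathsf T}\boldsymbol z\ge L-L_o$; - $\mathbf A\boldsymbol Y_f=\boldsymbol\gamma\mathbf e^{\mathsf T}-\mathbf F$; - $\boldsymbol Y_f=\mathbf K\boldsymbol Y_\theta+\boldsymbol\Phi_1^{\mathsf T}\mathbf U$ and $\mathbf K\boldsymbol\theta+\mathbf M\circ(\mathbf e-\boldsymbol z)-\boldsymbol\Phi_1^{\mathsf T}\mathbf t\ge\boldsymbol f$; - $\boldsymbol Y_f=\mathbf K\boldsymbol Y_\theta-\boldsymbol\Phi_2^{\mathsf T}\mathbf U$ and $\mathbf M\circ(\mathbf e-\boldsymbol z)-\boldsymbol\Phi_2^{\mathsf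 T}\mathbf t+\boldsymbol f\ge\mathbf K\boldsymbol\theta$. Chance-constrained inequalities: $\mathcal I$ indexes the scalar inequalities contained in $$\underline{\boldsymbol r}\le\boldsymbol\gamma\mathbf e^{\mathsf T}\boldsymbol\xi\le\overline{\boldsymbol r},\quad \underline{\boldsymbol g}\le\boldsymbol g+\boldsymbol\gamma\mathbf e^{\mathsf T}\boldsymbol\xi\le\overline{\boldsymbol g},\quad \underline{\boldsymbol\theta}\le\boldsymbol\theta+\boldsymbol Y_\theta\boldsymbol\xi\le\overline{\boldsymbol\theta},\quad \underline{\boldsymbol f}\circ\boldsymbol z\le\boldsymbol f+\boldsymbol Y_f\boldsymbol\xi\le\overline{\boldsymbol f}\circ\boldsymbol z;$$ each is written as $\mathbf a_i(\mathbf x)^{\mathsf T}\boldsymbol\xi\le b_i(\mathbf x)$ with $\mathbf a_i(\mathbf x)\in\mathbb R^K$ and $b_i(\mathbf x)\in\mathbb R$ affine in $\mathbf x$.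
   Formalization: Constants M_j valid on all x satisfying (D) exist only if (D) is infeasible; that literal case is proved. The equivalence is also proved with M_j valid only on decisions feasible for the DRCC-OTS problem and the δ-balls around the samples assumed contained in Ξ, without which it can fail. *)

theory Defs
  imports "HOL-Analysis.Analysis" "HOL-Probability.Probability"
begin

section \<open>Norms on Euclidean space, distributions and the Wasserstein distance of order infinity\<close>

definition is_norm :: "('a::real_vector \<Rightarrow> real) \<Rightarrow> bool" where
  "is_norm nu \<longleftrightarrow>
     (\<forall>x. 0 \<le> nu x) \<and> (\<forall>x. nu x = 0 \<longleftrightarrow> x = 0) \<and>
     (\<forall>c x. nu (c *\<^sub>R x) = \<bar>c\<bar> * nu x) \<and>
     (\<forall>x y. nu (x + y) \<le> nu x + nu y)"

definition dual_norm :: "('a::real_inner \<Rightarrow> real) \<Rightarrow> 'a \<Rightarrow> real" where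
  "dual_norm nu a = (SUP x\<in>{x. nu x \<le> 1}. a \<bullet> x)"

definition distributions_on :: "'a::topological_space set \<Rightarrow> 'a measure set" where
  "distributions_on A = {P. prob_space P \<and> sets P = sets borel \<and> emeasure P A = 1}"

definition couplings ::
    "'a::topological_space measure \<Rightarrow> 'a measure \<Rightarrow> ('a \<times> 'a) measure set" where
  "couplings P1 P2 =
     {P \<in> distributions_on UNIV. distr P borel fst = P1 \<and> distr P borel snd = P2}"

definition wasserstein_inf ::
    "('a::real_normed_vector \<Rightarrow> real) \<Rightarrow> 'a measure \<Rightarrow> 'a measure \<Rightarrow> ereal" where
  "wasserstein_inf nu P1 P2 =
     (INF P\<in>couplings P1 P2. esssup P (\<lambda>(x, y). ereal (nu (x - y))))"

definition empirical :: "nat \<Rightarrow> (nat \<Rightarrow> 'a::topological_space) \<Rightarrow> 'a measure" where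
  "empirical S xi = distr (uniform_count_measure {1..S}) borel xi"

definition wasserstein_inf_ball ::
    "('a::real_normed_vector \<Rightarrow> real) \<Rightarrow> 'a set \<Rightarrow> nat \<Rightarrow> (nat \<Rightarrow> 'a) \<Rightarrow> real \<Rightarrow> 'a measure set" where
  "wasserstein_inf_ball nu Xi S xi \<delta> =
     {P \<in> distributions_on Xi. wasserstein_inf nu P (empirical S xi) \<le> ereal \<delta>}"

section \<open>Network data, decisions and deterministic constraints\<close>

text \<open>
  Index types: \<open>'n\<close> buses, \<open>'l\<close> lines, \<open>'k\<close> components of the uncertainty,
  \<open>'w\<close> rows of the description of the support.  Line \<open>l\<close> is the pair
  \<open>(from_bus l, to_bus l)\<close>, and \<open>susceptance\<close> holds the inverse line reactances.
  On the type \<open>real ^ 'm\<close> the order, the multiplication \<open>*\<close> and the constants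
  \<open>0\<close> and \<open>1\<close> are component-wise, so \<open>*\<close> is the Hadamard product and \<open>1\<close>
  the all-ones vector.
\<close>

record ('n::finite, 'l::finite, 'k::finite, 'w::finite) network =
  from_bus :: "'l \<Rightarrow> 'n"
  to_bus :: "'l \<Rightarrow> 'n"
  susceptance :: "real ^ 'l"
  load :: "real ^ 'n"
  cost_c :: "real ^ 'n"
  cost_q :: "real ^ 'n"
  g_lo :: "real ^ 'n"
  g_up :: "real ^ 'n"
  \<theta>_lo :: "real ^ 'n"
  \<theta>_up :: "real ^ 'n"
  r_lo :: "real ^ 'n"
  r_up :: "real ^ 'n"
  f_lo :: "real ^ 'l"
  f_up :: "real ^ 'l"
  line_bigM :: "real ^ 'l"
  max_open :: nat
  F_mat :: "real ^ 'k ^ 'n"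
  U_mat :: "real ^ 'k ^ 'w"
  t_vec :: "real ^ 'w"

text \<open>
  A decision consists of \<open>g\<close> (\<open>gen\<close>), \<open>\<theta>\<close> (\<open>ang\<close>), \<open>f\<close> (\<open>flow\<close>), the binary \<open>z\<close>
  (\<open>switch\<close>, 0 for an open line), \<open>\<gamma>\<close> (\<open>part\<close>), the recourse matrices and the dual matrices.
\<close>

record ('n::finite, 'l::finite, 'k::finite, 'w::finite) decision =
  gen :: "real ^ 'n"
  ang :: "real ^ 'n"
  flow :: "real ^ 'l"
  switch :: "real ^ 'l"
  part :: "real ^ 'n"
  Y_ang :: "real ^ 'k ^ 'n"
  Y_flow :: "real ^ 'k ^ 'l"
  Phi1 :: "real ^ 'l ^ 'w"
  Phi2 :: "real ^ 'l ^ 'w"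

definition support :: "('n::finite, 'l::finite, 'k::finite, 'w::finite) network \<Rightarrow> (real ^ 'k) set" where
  "support D = {\<xi>. U_mat D *v \<xi> \<le> t_vec D}"

definition A_mat :: "('n::finite, 'l::finite, 'k::finite, 'w::finite) network \<Rightarrow> real ^ 'l ^ 'n" where
  "A_mat D = (\<chi> n l. (axis (from_bus D l) 1 - axis (to_bus D l) 1) $ n)"

definition K_mat :: "('n::finite, 'l::finite, 'k::finite, 'w::finite) network \<Rightarrow> real ^ 'n ^ 'l" where
  "K_mat D = (\<chi> l. susceptance D $ l *\<^sub>R (axis (from_bus D l) 1 - axis (to_bus D l) 1))"

definition outer :: "real ^ 'm \<Rightarrow> real ^ 'k \<Rightarrow> real ^ 'k ^ 'm" where
  "outer u v = (\<chi> i j. u $ i * v $ j)"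

definition det_feasible ::
    "('n::finite, 'l::finite, 'k::finite, 'w::finite) network \<Rightarrow> ('n, 'l, 'k, 'w) decision \<Rightarrow> bool" where
  "det_feasible D x \<longleftrightarrow>
     (\<forall>l. switch x $ l \<in> {0, 1}) \<and> 0 \<le> part x \<and> part x \<le> 1 \<and>
     0 \<le> Phi1 x \<and> 0 \<le> Phi2 x \<and>
     1 \<bullet> part x = 1 \<and>
     g_lo D \<le> gen x \<and> gen x \<le> g_up D \<and>
     \<theta>_lo D \<le> ang x \<and> ang x \<le> \<theta>_up D \<and>
     f_lo D * switch x \<le> flow x \<and> flow x \<le> f_up D * switch x \<and>
     A_mat D *v flow x = gen x - load D \<and>
     K_mat D *v ang x - flow x + line_bigM D * (1 - switch x) \<ge> 0 \<and>
     K_mat D *v ang x - flow x - line_bigM D * (1 - switch x) \<le> 0 \<and>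
     1 \<bullet> switch x \<ge> real CARD('l) - real (max_open D) \<and>
     A_mat D ** Y_flow x = outer (part x) 1 - F_mat D \<and>
     Y_flow x = K_mat D ** Y_ang x + transpose (Phi1 x) ** U_mat D \<and>
     K_mat D *v ang x + line_bigM D * (1 - switch x) - transpose (Phi1 x) *v t_vec D \<ge> flow x \<and>
     Y_flow x = K_mat D ** Y_ang x - transpose (Phi2 x) ** U_mat D \<and>
     line_bigM D * (1 - switch x) - transpose (Phi2 x) *v t_vec D + flow x \<ge> K_mat D *v ang x"

section \<open>The scalar inequalities subject to chance constraints\<close>

datatype ('n, 'l) ineq =
    RLo 'n | RUp 'n | GLo 'n | GUp 'n | ThLo 'n | ThUp 'n | FLo 'l | FUp 'l

fun ineq_a :: "('n::finite, 'l::finite) ineq \<Rightarrow> ('n, 'l, 'k::finite, 'w::finite) decision \<Rightarrow> real ^ 'k" where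
  "ineq_a (RLo n) x = - (part x $ n *\<^sub>R 1)"
| "ineq_a (RUp n) x = part x $ n *\<^sub>R 1"
| "ineq_a (GLo n) x = - (part x $ n *\<^sub>R 1)"
| "ineq_a (GUp n) x = part x $ n *\<^sub>R 1"
| "ineq_a (ThLo n) x = - (Y_ang x $ n)"
| "ineq_a (ThUp n) x = Y_ang x $ n"
| "ineq_a (FLo l) x = - (Y_flow x $ l)"
| "ineq_a (FUp l) x = Y_flow x $ l"

fun ineq_b ::
    "('n::finite, 'l::finite, 'k::finite, 'w::finite) network \<Rightarrow> ('n, 'l) ineq \<Rightarrow>
     ('n, 'l, 'k, 'w) decision \<Rightarrow> real" where
  "ineq_b D (RLo n) x = - (r_lo D $ n)"
| "ineq_b D (RUp n) x = r_up D $ n"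
| "ineq_b D (GLo n) x = gen x $ n - g_lo D $ n"
| "ineq_b D (GUp n) x = g_up D $ n - gen x $ n"
| "ineq_b D (ThLo n) x = ang x $ n - \<theta>_lo D $ n"
| "ineq_b D (ThUp n) x = \<theta>_up D $ n - ang x $ n"
| "ineq_b D (FLo l) x = flow x $ l - f_lo D $ l * switch x $ l"
| "ineq_b D (FUp l) x = f_up D $ l * switch x $ l - flow x $ l"

lemma all_ineq_iff:
  "(\<forall>i. P i) \<longleftrightarrow>
     (\<forall>n. P (RLo n)) \<and> (\<forall>n. P (RUp n)) \<and> (\<forall>n. P (GLo n)) \<and> (\<forall>n. P (GUp n)) \<and>
     (\<forall>n. P (ThLo n)) \<and> (\<forall>n. P (ThUp n)) \<and> (\<forall>l. P (FLo l)) \<and> (\<forall>l. P (FUp l))"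
  by (metis ineq.exhaust)

lemma ineqs_iff_vector_inequalities:
  fixes D :: "('n::finite, 'l::finite, 'k::finite, 'w::finite) network"
    and x :: "('n, 'l, 'k, 'w) decision"
  shows "(\<forall>i. ineq_a i x \<bullet> \<xi> \<le> ineq_b D i x) \<longleftrightarrow>
     r_lo D \<le> outer (part x) 1 *v \<xi> \<and> outer (part x) 1 *v \<xi> \<le> r_up D \<and>
     g_lo D \<le> gen x + outer (part x) 1 *v \<xi> \<and> gen x + outer (part x) 1 *v \<xi> \<le> g_up D \<and>
     \<theta>_lo D \<le> ang x + Y_ang x *v \<xi> \<and> ang x + Y_ang x *v \<xi> \<le> \<theta>_up D \<and>
     f_lo D * switch x \<le> flow x + Y_flow x *v \<xi> \<and> flow x + Y_flow x *v \<xi> \<le> f_up D * switch x"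
proof -
  have 1: "(outer (part x) 1 *v \<xi>) $ n = part x $ n * (1 \<bullet> \<xi>)" for n
    by (simp add: outer_def matrix_vector_mult_def inner_vec_def sum_distrib_left)
  have 2: "(Y_ang x *v \<xi>) $ n = Y_ang x $ n \<bullet> \<xi>" for n
    by (simp add: matrix_vector_mult_def inner_vec_def)
  have 3: "(Y_flow x *v \<xi>) $ l = Y_flow x $ l \<bullet> \<xi>" for l
    by (simp add: matrix_vector_mult_def inner_vec_def)
  show ?thesis
    unfolding all_ineq_iff
    by (simp add: less_eq_vec_def 1 2 3 algebra_simps)
qed

section \<open>The two optimization problems\<close>

text \<open>
  The expectation is taken under a distribution \<open>P\<close> of the uncertainty; only its mean
  matters, as the lemma following the definition shows.
\<close>

definition objective ::
    "('n::finite, 'l::finite, 'k::finite, 'w::finite) network \<Rightarrow> (real ^ 'k) measure \<Rightarrow>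
     ('n, 'l, 'k, 'w) decision \<Rightarrow> real" where
  "objective D P x = cost_c D \<bullet> gen x + (LINT \<xi>|P. (cost_q D \<bullet> part x) * (1 \<bullet> \<xi>))"

lemma objective_eq:
  assumes "integrable P (\<lambda>\<xi>. \<xi>)" and "(LINT \<xi>|P. \<xi>) = \<mu>"
  shows "objective D P x = cost_c D \<bullet> gen x + (cost_q D \<bullet> part x) * (1 \<bullet> \<mu>)"
  using assms by (simp add: objective_def)

text \<open>
  Worst-case probabilities are infima in \<^typ>\<open>ennreal\<close>, so that an empty ambiguity set
  would make the chance constraint vacuous.
\<close>

definition drcc_feasible ::
    "('n::finite, 'l::finite, 'k::finite, 'w::finite) network \<Rightarrow> (real ^ 'k) measure set \<Rightarrow>
     (('n, 'l) ineq \<Rightarrow> real) \<Rightarrow> ('n, 'l, 'k, 'w) decision set" where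
  "drcc_feasible D \<P> \<epsilon> =
     {x. det_feasible D x \<and>
         (\<forall>i. (INF P\<in>\<P>. emeasure P {\<xi>. ineq_a i x \<bullet> \<xi> \<le> ineq_b D i x}) \<ge> ennreal (1 - \<epsilon> i))}"

definition milp_feasible ::
    "('n::finite, 'l::finite, 'k::finite, 'w::finite) network \<Rightarrow> (real ^ 'k \<Rightarrow> real) \<Rightarrow>
     nat \<Rightarrow> (nat \<Rightarrow> real ^ 'k) \<Rightarrow> real \<Rightarrow> (nat \<Rightarrow> real) \<Rightarrow> (('n, 'l) ineq \<Rightarrow> real) \<Rightarrow>
     (('n, 'l, 'k, 'w) decision \<times> (('n, 'l) ineq \<Rightarrow> nat \<Rightarrow> real)) set" where
  "milp_feasible D nu S xi \<delta> M \<epsilon> =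
     {(x, w). det_feasible D x \<and>
        (\<forall>i. \<forall>j\<in>{1..S}. w i j \<in> {0, 1}) \<and>
        (\<forall>i. (\<Sum>j=1..S. w i j) \<le> real S * \<epsilon> i) \<and>
        (\<forall>i. \<forall>j\<in>{1..S}.
           \<delta> * dual_norm nu (ineq_a i x) \<le> ineq_b D i x - ineq_a i x \<bullet> xi j + M j * w i j)}"

text \<open>
  \<open>M j\<close> is valid on a set \<open>X\<close> of decisions if it bounds the stated expression for
  all of them, i.e. if it is at least the maximum over \<open>X\<close> (in particular finite).
\<close>

definition valid_bigM ::
    "('n::finite, 'l::finite, 'k::finite, 'w::finite) network \<Rightarrow> (real ^ 'k \<Rightarrow> real) \<Rightarrow>
     nat \<Rightarrow> (nat \<Rightarrow> real ^ 'k) \<Rightarrow> real \<Rightarrow> ('n, 'l, 'k, 'w) decision set \<Rightarrow> (nat \<Rightarrow> real) \<Rightarrow> bool" where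
  "valid_bigM D nu S xi \<delta> X M \<longleftrightarrow>
     (\<forall>j\<in>{1..S}. \<forall>i. \<forall>x\<in>X.
        ineq_a i x \<bullet> xi j + \<delta> * dual_norm nu (ineq_a i x) - ineq_b D i x \<le> M j)"

text \<open>
  Minimizing \<open>obj\<close> over \<open>X\<close> is equivalent to minimizing \<open>obj'\<close> over \<open>Y\<close>, where
  \<open>proj\<close> removes the auxiliary variables of the second problem.
\<close>

definition equivalent_problems ::
    "('x \<Rightarrow> real) \<Rightarrow> 'x set \<Rightarrow> ('y \<Rightarrow> real) \<Rightarrow> 'y set \<Rightarrow> ('y \<Rightarrow> 'x) \<Rightarrow> bool" where
  "equivalent_problems obj X obj' Y proj \<longleftrightarrow>
     proj ` Y = X \<and> (\<forall>y\<in>Y. obj' y = obj (proj y)) \<and>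
     (INF x\<in>X. ereal (obj x)) = (INF y\<in>Y. ereal (obj' y)) \<and>
     {x. is_arg_min obj (\<lambda>x. x \<in> X) x} = proj ` {y. is_arg_min obj' (\<lambda>y. y \<in> Y) y}"

text \<open>
  The rows of \<open>K_mat D\<close> sum to zero, so the deterministic constraints determine
  \<open>Y_ang\<close> only up to adding one and the same row vector to all of its rows.  Hence no
  constant is valid on all deterministically feasible decisions unless there are none.
\<close>

lemma is_norm_bounded_ball:
  fixes nu :: "'a::euclidean_space \<Rightarrow> real"
  assumes "is_norm nu"
  shows "bounded {x. nu x \<le> 1}"
proof -
  note N = assms[unfolded is_norm_def]
  have "convex_on UNIV nu"
  proof (rule convex_onI)
    fix t :: real and x y :: 'a
    assume "0 < t" "t < 1"
    have "nu ((1 - t) *\<^sub>R x + t *\<^sub>R y) \<le> nu ((1 - t) *\<^sub>R x) + nu (t *\<^sub>R y)"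
      using N by blast
    also have "\<dots> = (1 - t) * nu x + t * nu y"
      using N \<open>0 < t\<close> \<open>t < 1\<close> by simp
    finally show "nu ((1 - t) *\<^sub>R x + t *\<^sub>R y) \<le> (1 - t) * nu x + t * nu y" .
  qed simp
  then have cont: "continuous_on (sphere 0 1) nu"
    by (meson convex_on_continuous continuous_on_subset open_UNIV subset_UNIV)
  have ne: "sphere (0::'a) 1 \<noteq> {}"
    by simp
  obtain u where u: "u \<in> sphere 0 1" "\<And>y. y \<in> sphere 0 1 \<Longrightarrow> nu u \<le> nu y"
    using continuous_attains_inf[OF compact_sphere ne cont] by blast
  have "u \<noteq> 0"
    using u(1) by auto
  then have pos: "nu u > 0"
    using N by (metis less_eq_real_def)
  have "norm x \<le> 1 / nu u" if "nu x \<le> 1" for x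
  proof (cases "x = 0")
    case False
    have "nu u \<le> nu ((1 / norm x) *\<^sub>R x)"
      using u(2) False by simp
    also have "\<dots> = nu x / norm x"
      using N by simp
    also have "\<dots> \<le> 1 / norm x"
      using that by (simp add: divide_right_mono)
    finally show ?thesis
      using pos False by (simp add: field_simps)
  qed (use pos in simp)
  then show ?thesis
    by (auto simp: bounded_iff)
qed

lemma inner_le_dual_norm:
  fixes nu :: "'a::euclidean_space \<Rightarrow> real"
  assumes "is_norm nu" and "nu x \<le> 1"
  shows "a \<bullet> x \<le> dual_norm nu a"
proof -
  obtain B where B: "\<And>x. nu x \<le> 1 \<Longrightarrow> norm x \<le> B"
    using is_norm_bounded_ball[OF assms(1)] by (auto simp: bounded_iff)
  have "a \<bullet> y \<le> norm a * B" if "nu y \<le> 1" for y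
    using norm_cauchy_schwarz[of a y] B[OF that] by (meson mult_left_mono norm_ge_zero order_trans)
  then have "bdd_above ((\<bullet>) a ` {x. nu x \<le> 1})"
    by (auto intro!: bdd_aboveI)
  then show ?thesis
    unfolding dual_norm_def using assms(2) by (auto intro!: cSUP_upper)
qed

lemma det_feasible_shift_Y_ang:
  assumes "det_feasible D x"
  shows "det_feasible D (x\<lparr>Y_ang := Y_ang x + outer 1 v\<rparr>)"
proof -
  have "K_mat D ** outer 1 v = 0"
    by (simp add: vec_eq_iff matrix_matrix_mult_def K_mat_def outer_def
        sum_distrib_right[symmetric] sum_distrib_left[symmetric] sum_subtractf axis_def)
  then have "K_mat D ** (Y_ang x + outer 1 v) = K_mat D ** Y_ang x"
    by (simp add: matrix_add_ldistrib)
  note eq = this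
  define y where "y = x\<lparr>Y_ang := Y_ang x + outer 1 v\<rparr>"
  have "Y_ang y = Y_ang x + outer 1 v" "gen y = gen x" "ang y = ang x" "flow y = flow x"
    "switch y = switch x" "part y = part x" "Y_flow y = Y_flow x" "Phi1 y = Phi1 x" "Phi2 y = Phi2 x"
    by (simp_all add: y_def)
  then have "det_feasible D y \<longleftrightarrow> det_feasible D x"
    by (simp only: det_feasible_def eq)
  then show ?thesis
    using assms by (simp add: y_def)
qed

lemma valid_bigM_det_feasible_imp_infeasible:
  fixes D :: "('n::finite, 'l::finite, 'k::finite, 'w::finite) network"
  assumes "is_norm nu" "1 \<le> S" "0 < \<delta>"
    and "valid_bigM D nu S xi \<delta> {x. det_feasible D x} M"
  shows "\<not> det_feasible D x"
proof
  assume x: "det_feasible D x"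
  fix n :: 'n
  define C where "C = 2 * M 1 + (\<theta>_up D $ n - \<theta>_lo D $ n)"
  have bound: "2 * \<delta> * (a \<bullet> u) \<le> C" if u: "nu u \<le> 1" "nu (- u) \<le> 1" for a u :: "real ^ 'k"
  proof -
    define y where "y = x\<lparr>Y_ang := Y_ang x + outer 1 (a - Y_ang x $ n)\<rparr>"
    have y: "det_feasible D y"
      unfolding y_def by (rule det_feasible_shift_Y_ang[OF x])
    have a: "Y_ang y $ n = a"
      by (simp add: y_def outer_def vec_eq_iff)
    have "\<forall>i. ineq_a i y \<bullet> xi 1 + \<delta> * dual_norm nu (ineq_a i y) - ineq_b D i y \<le> M 1"
      using assms(2,4) y unfolding valid_bigM_def by auto
    from this[rule_format, of "ThUp n"] this[rule_format, of "ThLo n"]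
    have "\<delta> * (dual_norm nu a + dual_norm nu (- a)) \<le> C"
      by (simp add: a C_def algebra_simps)
    moreover have "a \<bullet> u + (- a) \<bullet> (- u) \<le> dual_norm nu a + dual_norm nu (- a)"
      using inner_le_dual_norm[OF assms(1)] u by (intro add_mono)
    then have "\<delta> * (2 * (a \<bullet> u)) \<le> \<delta> * (dual_norm nu a + dual_norm nu (- a))"
      using assms(3) by (intro mult_left_mono) auto
    ultimately show ?thesis
      by simp
  qed
  note N = assms(1)[unfolded is_norm_def]
  have "nu 1 > 0"
    using N by (metis less_eq_real_def zero_neq_one)
  define u :: "real ^ 'k" where "u = (1 / nu 1) *\<^sub>R 1"
  have scale: "nu (c *\<^sub>R z) = \<bar>c\<bar> * nu z" for c z
    using N by blast
  have "nu u = 1"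
    using \<open>nu 1 > 0\<close> by (simp add: u_def scale)
  moreover have "nu (- u) = nu u"
    using scale[of "-1" u] by simp
  ultimately have u: "nu u \<le> 1" "nu (- u) \<le> 1"
    by simp_all
  have uu: "u \<bullet> u > 0"
    using \<open>nu 1 > 0\<close> by (simp add: u_def)
  define s where "s = (\<bar>C\<bar> + 1) / (2 * \<delta> * (u \<bullet> u))"
  have "2 * \<delta> * ((s *\<^sub>R u) \<bullet> u) = \<bar>C\<bar> + 1"
    using uu assms(3) by (simp add: s_def)
  with bound[OF u, of "s *\<^sub>R u"] show False
    by linarith
qed

end

theory Submission
  imports Defs
begin

text \<open>
  A distribution within distance \<open>\<delta>\<close> of the empirical one puts mass at least \<open>|J| / S\<close> on the
  union of the \<open>\<delta>\<close>-balls around the samples in \<open>J\<close>, and a half-space \<open>a \<bullet> \<xi> \<le> b\<close> contains the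
  \<open>\<delta>\<close>-ball around \<open>xi j\<close> iff \<open>a \<bullet> xi j + \<delta> * dual_norm nu a \<le> b\<close>.  If that fails, the sample can
  be moved inside its ball, and thus inside the support, to a point violating the inequality;
  doing so for all such samples gives a worst-case distribution.  Hence the chance constraint
  says that at most \<open>S * \<epsilon>\<close> balls leave the half-space, and \<open>w i j = 1\<close> marks those.
  A big-M that is valid for all decisions satisfying the deterministic constraints exists only
  if there is no such decision, and then both problems are infeasible.
\<close>

section \<open>Norms on Euclidean space and their duals\<close>

text \<open>Convexity follows from the triangle inequality and homogeneity, and a finite convex
  function on a Euclidean space is continuous. This makes \<open>nu\<close>-balls closed, hence
  Borel.\<close>

lemma is_norm_continuous_on:
  fixes nu :: "'a::euclidean_space \<Rightarrow> real"
  assumes "is_norm nu"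
  shows "continuous_on A nu"
proof -
  note N = assms[unfolded is_norm_def]
  have "convex_on UNIV nu"
  proof (rule convex_onI)
    fix t :: real and x y :: 'a
    assume "0 < t" "t < 1"
    then show "nu ((1 - t) *\<^sub>R x + t *\<^sub>R y) \<le> (1 - t) * nu x + t * nu y"
      using N by (metis abs_of_pos diff_gt_0_iff_gt)
  qed simp
  then show ?thesis
    by (meson convex_on_continuous continuous_on_subset open_UNIV subset_UNIV)
qed

text \<open>Scaling by \<open>1 / \<delta>\<close> instead of \<open>1 / nu u\<close> lands in the
  unit ball without making \<open>u = 0\<close> a special case.\<close>

lemma is_norm_inner_le:
  fixes nu :: "'a::euclidean_space \<Rightarrow> real"
  assumes nu: "is_norm nu" and "0 < \<delta>" and "nu u \<le> \<delta>"
  shows "a \<bullet> u \<le> \<delta> * dual_norm nu a"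
proof -
  have "nu ((1 / \<delta>) *\<^sub>R u) = nu u / \<delta>"
    using nu \<open>0 < \<delta>\<close> by (simp add: is_norm_def)
  also have "\<dots> \<le> 1"
    using assms by simp
  finally have "a \<bullet> ((1 / \<delta>) *\<^sub>R u) \<le> dual_norm nu a"
    by (rule inner_le_dual_norm[OF nu])
  then show ?thesis
    using \<open>0 < \<delta>\<close> by (simp add: field_simps)
qed

text \<open>Attainment of the supremum is avoided: strictness leaves room for a point of the unit
  ball beyond \<open>c / \<delta>\<close>, which is then scaled by \<delta>.\<close>

lemma ex_inner_greater_of_dual_norm:
  fixes nu :: "'a::euclidean_space \<Rightarrow> real"
  assumes nu: "is_norm nu" and \<delta>: "0 < \<delta>" and c: "c < \<delta> * dual_norm nu a"
  shows "\<exists>u. nu u \<le> \<delta> \<and> c < a \<bullet> u"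
proof -
  have "c / \<delta> < (SUP x\<in>{x. nu x \<le> 1}. a \<bullet> x)"
    using \<delta> c by (simp add: dual_norm_def field_simps)
  moreover have "nu 0 = 0"
    using nu by (simp add: is_norm_def)
  ultimately obtain x where x: "nu x \<le> 1" "c / \<delta> < a \<bullet> x"
    by (metis (mono_tags, lifting) empty_iff image_iff image_is_empty less_cSupE
        mem_Collect_eq zero_le_one)
  have "nu (\<delta> *\<^sub>R x) \<le> \<delta>"
    using nu \<delta> x(1) by (simp add: is_norm_def)
  moreover have "c < a \<bullet> (\<delta> *\<^sub>R x)"
    using \<delta> x(2) by (simp add: field_simps)
  ultimately show ?thesis
    by blast
qed

section \<open>Uniform distributions on indexed points\<close>

lemma measurable_uniform_count_measure:
  assumes "y \<in> A \<rightarrow> space N"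
  shows "y \<in> measurable (uniform_count_measure A) N"
  using assms
  by (auto simp: measurable_def sets_uniform_count_measure space_uniform_count_measure)

text \<open>Counting indices rather than values gives repeated points their multiplicity.\<close>

lemma emeasure_distr_uniform_count:
  assumes "1 \<le> S" and "A \<in> sets N" and "y \<in> {1..S} \<rightarrow> space N"
  shows "emeasure (distr (uniform_count_measure {1..S}) N y) A
           = ennreal (real (card {j \<in> {1..S}. y j \<in> A}) / real S)"
proof -
  have "y \<in> measurable (uniform_count_measure {1..S}) N"
    by (rule measurable_uniform_count_measure) fact
  then have "emeasure (distr (uniform_count_measure {1..S}) N y) A
      = emeasure (uniform_count_measure {1..S}) (y -` A \<inter> {1..S})"
    using assms(2) by (simp add: emeasure_distr space_uniform_count_measure)
  also have "y -` A \<inter> {1..S} = {j \<in> {1..S}. y j \<in> A}"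
    by auto
  also have "emeasure (uniform_count_measure {1..S}) {j \<in> {1..S}. y j \<in> A}
      = ennreal (real (card {j \<in> {1..S}. y j \<in> A}) / real (card {1..S}))"
    by (rule emeasure_uniform_count_measure) auto
  finally show ?thesis
    by simp
qed

lemma distr_uniform_count_in_distributions_on:
  fixes S :: nat
  assumes "1 \<le> S" and "A \<in> sets borel" and "\<And>j. j \<in> {1..S} \<Longrightarrow> y j \<in> A"
  shows "distr (uniform_count_measure {1..S}) borel y \<in> distributions_on A"
proof -
  have 1: "y \<in> measurable (uniform_count_measure {1..S}) borel"
    by (simp add: measurable_uniform_count_measure)
  have "{j \<in> {1..S}. y j \<in> A} = {1..S}"
    using assms(3) by auto
  then have "emeasure (distr (uniform_count_measure {1..S}) borel y) A = 1"
    using assms(1) by (subst emeasure_distr_uniform_count[OF assms(1,2)]) auto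
  moreover have "prob_space (distr (uniform_count_measure {1..S}) borel y)"
    using assms(1) by (intro prob_space.prob_space_distr[OF prob_space_uniform_count_measure 1]) auto
  ultimately show ?thesis
    by (simp add: distributions_on_def)
qed

section \<open>Couplings and the Wasserstein ball\<close>

text \<open>Under \<open>Q\<close> the second coordinate is one of the samples of \<open>J\<close>
  with probability at least \<open>card J / S\<close>, and almost surely the first coordinate is
  within \<open>e\<close> of the second.\<close>

lemma coupling_empirical_emeasure_ge:
  fixes nu :: "'a::euclidean_space \<Rightarrow> real"
  assumes nu: "is_norm nu" and S: "1 \<le> S" and J: "J \<subseteq> {1..S}"
    and Q: "Q \<in> couplings P (empirical S xi)"
    and e: "esssup Q (\<lambda>(x, y). ereal (nu (x - y))) \<le> ereal e"
  shows "ennreal (real (card J) / real S) \<le> emeasure P (\<Union>j\<in>J. {\<xi>. nu (\<xi> - xi j) \<le> e})"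
proof -
  define B where "B = (\<Union>j\<in>J. {\<xi>. nu (\<xi> - xi j) \<le> e})"
  have fin: "finite J"
    using J finite_subset by blast
  have "closed {\<xi>. nu (\<xi> - xi j) \<le> e}" for j
    by (intro closed_Collect_le continuous_on_const
        continuous_on_compose2[OF is_norm_continuous_on[OF nu, of UNIV]] continuous_intros) auto
  then have B: "B \<in> sets borel"
    unfolding B_def using fin by (intro borel_closed closed_UN) auto
  have XJ: "xi ` J \<in> sets borel"
    using fin by (intro borel_closed finite_imp_closed) auto
  have sQ: "sets Q = sets borel" and P: "distr Q borel fst = P"
    and E: "distr Q borel snd = empirical S xi"
    using Q by (auto simp: couplings_def distributions_on_def)
  have [measurable]: "fst \<in> measurable Q borel" "snd \<in> measurable Q borel"
    by (auto simp: measurable_cong_sets[OF sQ refl] intro!: borel_measurable_continuous_onI continuous_intros)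
  \<comment> \<open>Only an inequality, since samples outside \<open>J\<close> may coincide with
    samples in \<open>J\<close>.\<close>
  have "ennreal (real (card J) / real S)
      \<le> ennreal (real (card {j \<in> {1..S}. xi j \<in> xi ` J}) / real S)"
    using J by (intro ennreal_leI divide_right_mono) (auto intro!: card_mono)
  also have "\<dots> = emeasure (empirical S xi) (xi ` J)"
    unfolding empirical_def by (rule emeasure_distr_uniform_count[OF S XJ, symmetric]) auto
  also have "\<dots> = emeasure Q (snd -` (xi ` J) \<inter> space Q)"
    unfolding E[symmetric] using XJ by (simp add: emeasure_distr)
  also have "\<dots> \<le> emeasure Q (fst -` B \<inter> space Q)"
  proof (rule emeasure_mono_AE)
    have "AE z in Q. (case z of (x, y) \<Rightarrow> ereal (nu (x - y))) \<le> ereal e"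
      using esssup_AE[of "\<lambda>(x, y). ereal (nu (x - y))" Q] e
      by (auto elim!: eventually_mono intro: order_trans)
    then show "AE z in Q. z \<in> snd -` (xi ` J) \<inter> space Q \<longrightarrow> z \<in> fst -` B \<inter> space Q"
      by (rule eventually_mono) (auto simp: B_def)
  qed (use B in measurable)
  also have "\<dots> = emeasure P B"
    unfolding P[symmetric] using B by (simp add: emeasure_distr)
  finally show ?thesis
    by (simp add: B_def)
qed

text \<open>The distance is an infimum over couplings, so the bound first holds for all larger radii.\<close>

lemma wasserstein_inf_ball_emeasure_ge:
  fixes nu :: "'a::euclidean_space \<Rightarrow> real"
  assumes nu: "is_norm nu" and S: "1 \<le> S" and J: "J \<subseteq> {1..S}"
    and P: "P \<in> wasserstein_inf_ball nu Xi S xi \<delta>"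
  shows "ennreal (real (card J) / real S) \<le> emeasure P (\<Union>j\<in>J. {\<xi>. nu (\<xi> - xi j) \<le> \<delta>})"
proof (cases "J = {}")
  case False
  define B where "B e = (\<Union>j\<in>J. {\<xi>. nu (\<xi> - xi j) \<le> e})" for e
  have fin: "finite J"
    using J finite_subset by blast
  have "closed {\<xi>. nu (\<xi> - xi j) \<le> e}" for j e
    by (intro closed_Collect_le continuous_on_const
        continuous_on_compose2[OF is_norm_continuous_on[OF nu, of UNIV]] continuous_intros) auto
  then have B: "B e \<in> sets borel" for e
    unfolding B_def using fin by (intro borel_closed closed_UN) auto
  have ps: "prob_space P" and sP: "sets P = sets borel"
    and W: "wasserstein_inf nu P (empirical S xi) \<le> ereal \<delta>"
    using P by (auto simp: wasserstein_inf_ball_def distributions_on_def)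
  interpret prob_space P by fact
  have ge: "ennreal (real (card J) / real S) \<le> emeasure P (B e)" if "\<delta> < e" for e
  proof -
    have "wasserstein_inf nu P (empirical S xi) < ereal e"
      using W that by (simp add: order_le_less_trans)
    then obtain Q where "Q \<in> couplings P (empirical S xi)"
      "esssup Q (\<lambda>(x, y). ereal (nu (x - y))) < ereal e"
      by (auto simp: wasserstein_inf_def INF_less_iff)
    then show ?thesis
      unfolding B_def by (intro coupling_empirical_emeasure_ge[OF nu S J]) auto
  qed
  \<comment> \<open>The union of balls is a sublevel set of the distance to the nearest sample of
    \<open>J\<close>, so membership passes to the limit of the radii. \<open>Min\<close> requires
    \<open>J\<close> nonempty, hence the case split.\<close>
  have B_Min: "\<xi> \<in> B e \<longleftrightarrow> Min ((\<lambda>j. nu (\<xi> - xi j)) ` J) \<le> e" for \<xi> e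
    using fin False by (auto simp: B_def Min_le_iff)
  have B_mono: "B e \<subseteq> B e'" if "e \<le> e'" for e e'
    using that unfolding B_def by (intro UN_mono) auto
  \<comment> \<open>Radii strictly above \<delta> and decreasing to it: \<open>ge\<close> applies to
    each, and continuity of the measure from above yields \<delta> itself.\<close>
  define r where "r n = \<delta> + inverse (real (Suc n))" for n
  have "\<xi> \<in> B \<delta>" if "\<And>n. \<xi> \<in> B (r n)" for \<xi>
  proof -
    have "r \<longlonglongrightarrow> \<delta>"
      unfolding r_def using LIMSEQ_inverse_real_of_nat_add by simp
    then show ?thesis
      using that unfolding B_Min by (intro LIMSEQ_le_const[of r]) auto
  qed
  moreover have "B \<delta> \<subseteq> B (r n)" for n
    by (rule B_mono) (simp add: r_def)
  ultimately have "(\<Inter>n. B (r n)) = B \<delta>"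
    by blast
  moreover have "decseq (\<lambda>n. B (r n))"
  proof (rule antimonoI)
    fix m n :: nat assume "m \<le> n"
    then show "B (r n) \<subseteq> B (r m)"
      by (intro B_mono) (simp add: r_def le_imp_inverse_le)
  qed
  ultimately have "emeasure P (B \<delta>) = (INF n. emeasure P (B (r n)))"
    using INF_emeasure_decseq[of "\<lambda>n. B (r n)" P] B sP by (simp add: image_subset_iff)
  also have "\<dots> \<ge> ennreal (real (card J) / real S)"
    by (intro INF_greatest ge) (simp add: r_def)
  finally show ?thesis
    by (simp add: B_def)
qed simp

text \<open>Pairing the moved point \<open>y j\<close> with the sample \<open>xi j\<close> gives a
  coupling whose displacement is almost surely at most \<delta>.\<close>

lemma distr_uniform_count_in_wasserstein_inf_ball:
  fixes nu :: "'a::euclidean_space \<Rightarrow> real"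
  assumes nu: "is_norm nu" and S: "1 \<le> S" and Xi: "Xi \<in> sets borel"
    and y: "\<And>j. j \<in> {1..S} \<Longrightarrow> y j \<in> Xi \<and> nu (y j - xi j) \<le> \<delta>"
  shows "distr (uniform_count_measure {1..S}) borel y \<in> wasserstein_inf_ball nu Xi S xi \<delta>"
proof -
  define U where "U = uniform_count_measure {1..S}"
  define Q where "Q = distr U borel (\<lambda>j. (y j, xi j))"
  have U: "xi \<in> measurable U borel" "y \<in> measurable U borel" "(\<lambda>j. (y j, xi j)) \<in> measurable U borel"
    by (simp_all add: U_def measurable_uniform_count_measure)
  have fs: "fst \<in> measurable borel borel" "snd \<in> measurable borel borel"
    by (intro borel_measurable_continuous_onI continuous_intros)+
  have "Q \<in> couplings (distr U borel y) (empirical S xi)"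
    using distr_uniform_count_in_distributions_on[OF S, of UNIV "\<lambda>j. (y j, xi j)"]
    unfolding couplings_def Q_def empirical_def U_def[symmetric]
    by (simp add: distr_distr[OF fs(1) U(3)] distr_distr[OF fs(2) U(3)] comp_def)
  moreover have "esssup Q (\<lambda>(x, y). ereal (nu (x - y))) \<le> ereal \<delta>"
  proof (rule esssup_I)
    \<comment> \<open>\<open>esssup\<close> is infinite by convention for nonmeasurable functions,
      so measurability has to be established.\<close>
    have c: "continuous_on UNIV (\<lambda>z::'a \<times> 'a. nu (fst z - snd z))"
      by (intro continuous_on_compose2[OF is_norm_continuous_on[OF nu, of UNIV]] continuous_intros) auto
    then have m: "(\<lambda>z::'a \<times> 'a. nu (fst z - snd z)) \<in> borel_measurable borel"
      by (rule borel_measurable_continuous_onI)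
    then show "(\<lambda>(x, y). ereal (nu (x - y))) \<in> borel_measurable Q"
      by (simp add: Q_def case_prod_beta)
    have "{z::'a \<times> 'a. nu (fst z - snd z) \<le> \<delta>} \<in> sets borel"
      by (intro borel_closed closed_Collect_le c continuous_on_const)
    then show "AE z in Q. (case z of (x, y) \<Rightarrow> ereal (nu (x - y))) \<le> ereal \<delta>"
      unfolding Q_def using y
      by (subst AE_distr_iff[OF U(3)]) (auto simp: case_prod_beta U_def space_uniform_count_measure)
  qed
  ultimately have "wasserstein_inf nu (distr U borel y) (empirical S xi) \<le> ereal \<delta>"
    unfolding wasserstein_inf_def by (meson INF_lower order_trans)
  moreover have "distr U borel y \<in> distributions_on Xi"
    unfolding U_def using y by (intro distr_uniform_count_in_distributions_on S Xi) auto
  ultimately show ?thesis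
    by (simp add: wasserstein_inf_ball_def U_def)
qed

section \<open>Worst-case probability of a half-space\<close>

text \<open>\<open>balls\<close> serves the left-to-right direction: it keeps the moved samples
  inside \<open>Xi\<close>, so that the worst-case distribution is admissible.\<close>

lemma worst_case_halfspace_ge_iff:
  fixes nu :: "'a::euclidean_space \<Rightarrow> real"
  assumes nu: "is_norm nu" and S: "1 \<le> S" and \<delta>: "0 < \<delta>" and Xi: "Xi \<in> sets borel"
    and balls: "\<And>j. j \<in> {1..S} \<Longrightarrow> {\<xi>. nu (\<xi> - xi j) \<le> \<delta>} \<subseteq> Xi"
  shows "ennreal p \<le> (INF P\<in>wasserstein_inf_ball nu Xi S xi \<delta>. emeasure P {\<xi>. a \<bullet> \<xi> \<le> b}) \<longleftrightarrow>
     p \<le> real (card {j \<in> {1..S}. a \<bullet> xi j + \<delta> * dual_norm nu a \<le> b}) / real S"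
    (is "_ \<le> (INF P\<in>?W. emeasure P ?H) \<longleftrightarrow> _ \<le> real (card ?G) / _")
proof
  have H: "?H \<in> sets borel"
    by (intro borel_closed closed_halfspace_le)
  assume p: "p \<le> real (card ?G) / real S"
  show "ennreal p \<le> (INF P\<in>?W. emeasure P ?H)"
  proof (rule INF_greatest)
    fix P assume P: "P \<in> ?W"
    have "ennreal p \<le> ennreal (real (card ?G) / real S)"
      using p by (rule ennreal_leI)
    also have "\<dots> \<le> emeasure P (\<Union>j\<in>?G. {\<xi>. nu (\<xi> - xi j) \<le> \<delta>})"
      by (rule wasserstein_inf_ball_emeasure_ge[OF nu S _ P]) auto
    also have "\<dots> \<le> emeasure P ?H"
    proof (rule emeasure_mono)
      show "?H \<in> sets P"
        using P H by (simp add: wasserstein_inf_ball_def distributions_on_def)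
      \<comment> \<open>Split \<open>\<xi>\<close> as \<open>xi j + (\<xi> - xi j)\<close>; the
        second summand contributes at most \<open>\<delta> * dual_norm nu a\<close>.\<close>
      show "(\<Union>j\<in>?G. {\<xi>. nu (\<xi> - xi j) \<le> \<delta>}) \<subseteq> ?H"
        using is_norm_inner_le[OF nu \<delta>, of _ a] by (fastforce simp: inner_diff_right)
    qed
    finally show "ennreal p \<le> emeasure P ?H" .
  qed
next
  have H: "?H \<in> sets borel"
    by (intro borel_closed closed_halfspace_le)
  assume p: "ennreal p \<le> (INF P\<in>?W. emeasure P ?H)"
  \<comment> \<open>Samples whose ball fits in the half-space stay put; every other one is pushed
    out of it. The implication covers both cases in a single choice of \<open>y\<close>.\<close>
  have "\<exists>\<xi>. nu (\<xi> - xi j) \<le> \<delta> \<and> (a \<bullet> \<xi> \<le> b \<longrightarrow> a \<bullet> xi j + \<delta> * dual_norm nu a \<le> b)" for j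
  proof (cases "a \<bullet> xi j + \<delta> * dual_norm nu a \<le> b")
    case True
    have "nu (xi j - xi j) = 0"
      using nu by (simp add: is_norm_def)
    then have "nu (xi j - xi j) \<le> \<delta>"
      using \<delta> by simp
    with True show ?thesis by blast
  next
    case False
    then obtain u where "nu u \<le> \<delta>" "b - a \<bullet> xi j < a \<bullet> u"
      using ex_inner_greater_of_dual_norm[OF nu \<delta>, of "b - a \<bullet> xi j" a] by auto
    then show ?thesis
      by (intro exI[of _ "xi j + u"]) (simp add: inner_add_right)
  qed
  then obtain y where y: "\<And>j. nu (y j - xi j) \<le> \<delta>"
    and yG: "\<And>j. a \<bullet> y j \<le> b \<Longrightarrow> a \<bullet> xi j + \<delta> * dual_norm nu a \<le> b"
    by metis
  let ?P = "distr (uniform_count_measure {1..S}) borel y"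
  have "?P \<in> ?W"
    using y balls by (intro distr_uniform_count_in_wasserstein_inf_ball nu S Xi) auto
  with p have "ennreal p \<le> emeasure ?P ?H"
    by (meson INF_lower order_trans)
  also have "\<dots> = ennreal (real (card {j \<in> {1..S}. y j \<in> ?H}) / real S)"
    using S H by (intro emeasure_distr_uniform_count) auto
  also have "\<dots> \<le> ennreal (real (card ?G) / real S)"
    using yG by (intro ennreal_leI divide_right_mono) (auto intro!: card_mono)
  \<comment> \<open>For negative \<open>p\<close> the truncation by \<open>ennreal\<close> is
    harmless, because the right-hand side is nonnegative.\<close>
  finally show "p \<le> real (card ?G) / real S"
    by (simp add: ennreal_le_iff)
qed

section \<open>Binary encoding and equivalence of the problems\<close>

text \<open>Validity of \<open>M\<close> enters when a chance-feasible \<open>x\<close> is given its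
  \<open>w\<close>: where \<open>w i j = 1\<close>, the constraint is the big-M inequality at
  \<open>x\<close>. Hence validity is asked on the chance-feasible decisions.\<close>

lemma drcc_feasible_eq_fst_milp_feasible:
  fixes D :: "('n::finite, 'l::finite, 'k::finite, 'w::finite) network"
  assumes nu: "is_norm nu" and S: "1 \<le> S" and \<delta>: "0 < \<delta>"
    and supp: "support D \<in> sets borel"
    and balls: "\<And>j. j \<in> {1..S} \<Longrightarrow> {\<xi>. nu (\<xi> - xi j) \<le> \<delta>} \<subseteq> support D"
    and bigM: "valid_bigM D nu S xi \<delta> (drcc_feasible D (wasserstein_inf_ball nu (support D) S xi \<delta>) \<epsilon>) M"
  shows "fst ` milp_feasible D nu S xi \<delta> M \<epsilon>
           = drcc_feasible D (wasserstein_inf_ball nu (support D) S xi \<delta>) \<epsilon>"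
    (is "fst ` ?XW = ?X")
proof -
  define G where "G i x = {j \<in> {1..S}. ineq_a i x \<bullet> xi j + \<delta> * dual_norm nu (ineq_a i x) \<le> ineq_b D i x}"
    for i and x :: "('n, 'l, 'k, 'w) decision"
  \<comment> \<open>Multiplying by \<open>S\<close> turns the probability bound into a bound on the
    number of samples outside \<open>G i x\<close>.\<close>
  have X: "x \<in> ?X \<longleftrightarrow> det_feasible D x \<and> (\<forall>i. real S - real (card (G i x)) \<le> real S * \<epsilon> i)" for x
    unfolding drcc_feasible_def mem_Collect_eq G_def
    using S by (subst worst_case_halfspace_ge_iff[OF nu S \<delta> supp balls]) (auto simp: field_simps)
  have bad: "(\<Sum>j=1..S. if j \<in> G i x then 0 else 1) = real S - real (card (G i x))" for i x
  proof -
    have G: "G i x \<subseteq> {1..S}"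
      by (auto simp: G_def)
    have "(\<Sum>j=1..S. if j \<in> G i x then 0 else 1) = real (card ({1..S} - G i x))"
      by (simp add: sum.If_cases Diff_eq)
    also have "\<dots> = real S - real (card (G i x))"
      using G card_mono[of "{1..S}" "G i x"]
      by (subst card_Diff_subset) (auto intro: finite_subset)
    finally show ?thesis .
  qed
  have "x \<in> ?X" if "(x, w) \<in> ?XW" for x w
  proof -
    have x: "det_feasible D x" and w: "\<And>i j. j \<in> {1..S} \<Longrightarrow> w i j \<in> {0, 1}"
      and sum: "\<And>i. (\<Sum>j=1..S. w i j) \<le> real S * \<epsilon> i"
      and le: "\<And>i j. j \<in> {1..S} \<Longrightarrow> \<delta> * dual_norm nu (ineq_a i x)
          \<le> ineq_b D i x - ineq_a i x \<bullet> xi j + M j * w i j"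
      using that by (auto simp: milp_feasible_def)
    have "real S - real (card (G i x)) \<le> (\<Sum>j=1..S. w i j)" for i
    proof -
      have "real S - real (card (G i x)) = (\<Sum>j=1..S. if j \<in> G i x then 0 else 1)"
        by (rule bad[symmetric])
      also have "\<dots> \<le> (\<Sum>j=1..S. w i j)"
      proof (rule sum_mono)
        fix j assume j: "j \<in> {1..S}"
        \<comment> \<open>If \<open>w i j = 0\<close>, the constraint itself says
          \<open>j \<in> G i x\<close>, so every other sample has \<open>w i j = 1\<close>.\<close>
        show "(if j \<in> G i x then 0 else 1) \<le> w i j"
          using w[OF j, of i] le[OF j, of i] j by (auto simp: G_def)
      qed
      finally show ?thesis .
    qed
    then show ?thesis
      unfolding X using x sum by (meson order_trans)
  qed
  moreover have "\<exists>w. (x, w) \<in> ?XW" if x: "x \<in> ?X" for x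
  proof -
    \<comment> \<open>The least admissible choice: only the samples that must be marked are
      marked.\<close>
    define w where "w i j = (if j \<in> G i x then 0 else 1 :: real)" for i j
    have "(\<Sum>j=1..S. w i j) = real S - real (card (G i x))" for i
      unfolding w_def by (rule bad)
    moreover have "\<delta> * dual_norm nu (ineq_a i x) \<le> ineq_b D i x - ineq_a i x \<bullet> xi j + M j * w i j"
      if "j \<in> {1..S}" for i j
    proof (cases "j \<in> G i x")
      case True
      then show ?thesis by (simp add: w_def G_def)
    next
      case False
      then show ?thesis
        using bigM x that by (auto simp: valid_bigM_def w_def algebra_simps)
    qed
    ultimately have "(x, w) \<in> ?XW"
      using x[unfolded X] by (simp add: milp_feasible_def) (simp add: w_def)
    then show ?thesis by blast
  qed
  ultimately show ?thesis
    by force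
qed

text \<open>The second objective factors through \<open>proj\<close>, so both problems attain the
  same values; infima and minimizers then correspond.\<close>

lemma equivalent_problems_image:
  assumes "proj ` Y = X" and "\<And>y. y \<in> Y \<Longrightarrow> obj' y = obj (proj y)"
  shows "equivalent_problems obj X obj' Y proj"
  unfolding equivalent_problems_def
proof (intro conjI)
  show "(INF x\<in>X. ereal (obj x)) = (INF y\<in>Y. ereal (obj' y))"
    unfolding assms(1)[symmetric] image_image using assms(2) by (intro INF_cong) auto
  show "{x. is_arg_min obj (\<lambda>x. x \<in> X) x} = proj ` {y. is_arg_min obj' (\<lambda>y. y \<in> Y) y}"
    unfolding assms(1)[symmetric] using assms(2) by (auto simp: is_arg_min_def)
qed (use assms in auto)

theorem proposition4:
  fixes D :: "('n::finite, 'l::finite, 'k::finite, 'w::finite) network"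
    and nu :: "real ^ 'k \<Rightarrow> real"
    and P\<^sub>0 :: "(real ^ 'k) measure"
    and \<mu> :: "real ^ 'k"
    and S :: nat
    and xi :: "nat \<Rightarrow> real ^ 'k"
    and \<delta> :: real
    and M :: "nat \<Rightarrow> real"
    and \<epsilon> :: "('n, 'l) ineq \<Rightarrow> real"
  assumes norm: "is_norm nu"
    and support_compact: "compact (support D)"
    and support_full_dim: "aff_dim (support D) = int CARD('k)"
    and P\<^sub>0: "P\<^sub>0 \<in> distributions_on (support D)"
    and mean: "(LINT \<xi>|P\<^sub>0. \<xi>) = \<mu>"
    and S: "1 \<le> S"
    and \<delta>: "0 < \<delta>"
    and \<epsilon>: "\<And>i. 0 < \<epsilon> i \<and> \<epsilon> i < 1"
  defines "X \<equiv> drcc_feasible D (wasserstein_inf_ball nu (support D) S xi \<delta>) \<epsilon>"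
    and "XW \<equiv> milp_feasible D nu S xi \<delta> M \<epsilon>"
  shows
    "(valid_bigM D nu S xi \<delta> {x. det_feasible D x} M \<longrightarrow>
        equivalent_problems (objective D P\<^sub>0) X (\<lambda>(x, w). objective D P\<^sub>0 x) XW fst) \<and>
     (valid_bigM D nu S xi \<delta> X M \<and>
      (\<forall>j\<in>{1..S}. {\<xi>. nu (\<xi> - xi j) \<le> \<delta>} \<subseteq> support D) \<longrightarrow>
        equivalent_problems (objective D P\<^sub>0) X (\<lambda>(x, w). objective D P\<^sub>0 x) XW fst)"
proof -
  have eq: "equivalent_problems (objective D P\<^sub>0) X (\<lambda>(x, w). objective D P\<^sub>0 x) XW fst"
    if "fst ` XW = X"
    using that by (rule equivalent_problems_image) auto
  \<comment> \<open>Without deterministically feasible decisions both \<open>X\<close> and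
    \<open>XW\<close> are empty.\<close>
  have "fst ` XW = X" if "valid_bigM D nu S xi \<delta> {x. det_feasible D x} M"
    using valid_bigM_det_feasible_imp_infeasible[OF norm S \<delta> that]
    by (auto simp: X_def XW_def drcc_feasible_def milp_feasible_def)
  moreover have "fst ` XW = X"
    if "valid_bigM D nu S xi \<delta> X M" "\<forall>j\<in>{1..S}. {\<xi>. nu (\<xi> - xi j) \<le> \<delta>} \<subseteq> support D"
    using drcc_feasible_eq_fst_milp_feasible[OF norm S \<delta>, of D xi \<epsilon> M] that support_compact
    by (auto simp: X_def XW_def intro: borel_compact)
  ultimately show ?thesis
    using eq by blast
qed

end
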